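(* Let $k\ge 1$ be a natural number, let $I\subset\mathbb{R}$ be a subset of cardinality $|I|>k$, and let $M$ be a set. Let $\varphi\colon a\mapsto\varphi_a$ be a surjective map with $\operatorname{dom}\varphi\subset\bigcup_{\alpha\in C_k(I)}M^\alpha$ and $\operatorname{cod}\varphi\subset M^I$. Then $\varphi$ is a flow with limited intersection of worldlines if and only if for every $a\in\operatorname{dom}\varphi$ and every $\beta\in C_k(I)$ $$\varphi_{\varphi_a|_\beta}=\varphi_a,\qquad \varphi_a|_{\operatorname{dom}a}=a,$$ where the first equality includes the assertion that $\varphi_a|_\beta\in\operatorname{dom}\varphi$.
   Context: Notation. For a set $S$, $C_k(S)$ is the set of all subsets of $S$ with exactly $k$ elements. $M^S$ is the set of all maps from $S$ to $M$. Maps are identified with their graphs, so for maps $x_1,x_2$ the set $x_1\cap x_2$ is the intersection of graphs, $|x_1\cap x_2|$ is its cardinality, and $a\subset x$ means that the map $a$ is a restriction of the map $x$. For a map $x\in M^I$, $C_k(x)$ is the set of all subsets $a\subset x$ (of the graph) with $|a|=k$; each such $a$ is a map with $\operatorname{dom}a\in C_k(I)$ and $a=x|_{\operatorname{dom}a}$. $\operatorname{dom}$ and $\operatorname{cod}$ denote domain and codomain; for a surjective map the codomain is its image. Set of worldlines with limited intersection: a set $X\subset M^I$ such that for all $x_1,x_2\in X$: $|x_1\cap x_2|\ge k\Rightarrow x_1=x_2$. Flow with limited intersection of worldlines: a surjective map $\varphi\colon A\to X$, $a\mapsto\varphi_a$, where $X\subset M^I$ is a set of worldlines with limited intersection, $A=\bigcup_{x\in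 X}C_k(x)$, and $\varphi_a\supset a$ for all $a\in A$. *)

theory Defs
  imports Complex_Main "HOL-Library.Ramsey"
begin

text \<open>
  A map is a partial function \<open>x :: 'a \<rightharpoonup> 'b\<close>. The identification of maps with their graphs
  is made through \<^const>\<open>Map.graph\<close>; \<open>a \<subseteq>\<^sub>m x\<close> says that \<open>a\<close> is a restriction of \<open>x\<close>, and
  \<open>x |` \<beta>\<close> is the restriction of \<open>x\<close> to \<open>\<beta>\<close>. The set \<open>C\<^sub>k(S)\<close> of \<open>k\<close>-element subsets
  is \<^term>\<open>nsets S k\<close>.
\<close>

definition maps_on :: "'a set \<Rightarrow> 'b set \<Rightarrow> ('a \<rightharpoonup> 'b) set" where
  "maps_on S M = {x. dom x = S \<and> ran x \<subseteq> M}"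

definition submaps :: "nat \<Rightarrow> ('a \<rightharpoonup> 'b) \<Rightarrow> ('a \<rightharpoonup> 'b) set" where
  "submaps k x = {a. Map.graph a \<in> nsets (Map.graph x) k}"

text \<open>
  Cardinality lower bounds have to admit infinite sets explicitly, because \<^const>\<open>card\<close> is \<open>0\<close> on them.
\<close>

definition card_ge :: "'a set \<Rightarrow> nat \<Rightarrow> bool" where
  "card_ge S n \<longleftrightarrow> infinite S \<or> n \<le> card S"

definition limited_intersection ::
  "nat \<Rightarrow> real set \<Rightarrow> 'm set \<Rightarrow> (real \<rightharpoonup> 'm) set \<Rightarrow> bool" where
  "limited_intersection k I M X \<longleftrightarrow>
     X \<subseteq> maps_on I M \<and>
     (\<forall>x1\<in>X. \<forall>x2\<in>X. card_ge (Map.graph x1 \<inter> Map.graph x2) k \<longrightarrow> x1 = x2)"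

text \<open>
  A surjective map \<open>\<phi> : A \<rightarrow> X\<close> is a partial function with domain \<open>A\<close> and range \<open>X\<close>;
  for \<open>a \<in> dom \<phi>\<close>, the value \<open>\<phi>\<^sub>a\<close> is \<open>the (\<phi> a)\<close>.
\<close>

definition limited_intersection_flow ::
  "nat \<Rightarrow> real set \<Rightarrow> 'm set \<Rightarrow> ((real \<rightharpoonup> 'm) \<rightharpoonup> (real \<rightharpoonup> 'm)) \<Rightarrow> bool" where
  "limited_intersection_flow k I M \<phi> \<longleftrightarrow>
     (\<exists>A X. limited_intersection k I M X \<and>
            A = (\<Union>x\<in>X. submaps k x) \<and>
            dom \<phi> = A \<and> ran \<phi> = X \<and>
            (\<forall>a\<in>A. a \<subseteq>\<^sub>m the (\<phi> a)))"

end

theory Submission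
  imports Defs
begin

text \<open>
  Two worldlines meet in at least \<open>k\<close> points iff they have a common \<open>k\<close>-point submap. Hence
  the intersection condition says that a \<open>k\<close>-point map extends to at most one worldline, and
  \<open>\<phi>\<close> is forced to pick that worldline.
\<close>

lemma graph_subset_iff: "Map.graph a \<subseteq> Map.graph x \<longleftrightarrow> a \<subseteq>\<^sub>m x"
proof
  assume sub: "Map.graph a \<subseteq> Map.graph x"
  show "a \<subseteq>\<^sub>m x"
    unfolding map_le_def
  proof
    fix i assume "i \<in> dom a"
    then obtain m where "a i = Some m" by blast
    then show "a i = x i"
      using sub by (auto simp: Map.graph_def)
  qed
next
  assume le: "a \<subseteq>\<^sub>m x"
  show "Map.graph a \<subseteq> Map.graph x"
  proof (rule subrelI)
    fix i m assume "(i, m) \<in> Map.graph a"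
    then have "a i = Some m"
      by (simp add: Map.graph_def)
    moreover from this have "a i = x i"
      using le unfolding map_le_def by blast
    ultimately show "(i, m) \<in> Map.graph x"
      by (simp add: Map.graph_def)
  qed
qed

lemma card_graph: "card (Map.graph a) = card (dom a)"
  by (metis card_image fst_graph_eq_dom inj_on_fst_graph)

text \<open>Links the extension condition in the definition of a flow with the second equality of
  the theorem.\<close>

lemma map_le_iff_restrict: "a \<subseteq>\<^sub>m x \<longleftrightarrow> x |` dom a = a"
proof
  assume le: "a \<subseteq>\<^sub>m x"
  show "x |` dom a = a"
  proof
    fix i
    have "i \<in> dom a \<Longrightarrow> x i = a i"
      using le unfolding map_le_def by metis
    then show "(x |` dom a) i = a i"
      by (cases "i \<in> dom a") (simp_all add: restrict_map_def domIff)
  qed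
next
  assume eq: "x |` dom a = a"
  show "a \<subseteq>\<^sub>m x"
    unfolding map_le_def
  proof
    fix i assume "i \<in> dom a"
    from restrict_in[OF this, of x] show "a i = x i"
      unfolding eq .
  qed
qed

text \<open>The first projection is a bijection from the graph of \<open>a\<close> to
  \<open>dom a\<close>, so counting graph points is counting times.\<close>

lemma submaps_iff:
  "a \<in> submaps k x \<longleftrightarrow> a \<subseteq>\<^sub>m x \<and> dom a \<in> nsets (dom x) k"
  using map_le_implies_dom_le[of a x]
  by (simp add: submaps_def nsets_def graph_subset_iff card_graph)
    blast

lemma restrict_in_submaps:
  assumes "\<beta> \<in> nsets (dom x) k"
  shows "x |` \<beta> \<in> submaps k x" "dom (x |` \<beta>) = \<beta>"
proof -
  show "dom (x |` \<beta>) = \<beta>"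
    using assms by (auto simp: nsets_def)
  then show "x |` \<beta> \<in> submaps k x"
    using assms by (simp add: submaps_iff map_le_iff_restrict)
qed

text \<open>Any subset of a graph is itself the graph of a map, so the k-point subsets of the
  intersection are exactly the graphs of the common k-point submaps.\<close>

lemma card_ge_graph_Int_iff:
  "card_ge (Map.graph x \<inter> Map.graph y) k \<longleftrightarrow> (\<exists>a. a \<in> submaps k x \<and> a \<in> submaps k y)"
proof
  assume "card_ge (Map.graph x \<inter> Map.graph y) k"
  then obtain g where g: "g \<subseteq> Map.graph x \<inter> Map.graph y" "finite g" "card g = k"
    unfolding card_ge_def
  proof
    assume "infinite (Map.graph x \<inter> Map.graph y)"
    then show ?thesis
      using infinite_arbitrarily_large that by blast
  next
    assume "k \<le> card (Map.graph x \<inter> Map.graph y)"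
    then show ?thesis
      using obtain_subset_with_card_n that by metis
  qed
  \<comment> \<open>Since \<open>g\<close> lies in the graph of \<open>x\<close>, it is
    single-valued, and restricting \<open>x\<close> to its first coordinates recovers it. As
    \<open>g\<close> also lies in the graph of \<open>y\<close>, this restriction serves as the
    common submap.\<close>
  have "Map.graph (x |` (fst ` g)) = g"
  proof (intro equalityI subrelI)
    fix i m assume "(i, m) \<in> Map.graph (x |` (fst ` g))"
    then have "x i = Some m" "i \<in> fst ` g"
      by (auto simp: Map.graph_def restrict_map_def split: if_splits)
    then obtain m' where "(i, m') \<in> g" by auto
    with g(1) \<open>x i = Some m\<close> show "(i, m) \<in> g"
      by (auto simp: Map.graph_def)
  next
    fix i m assume "(i, m) \<in> g"
    moreover from this have "x i = Some m" "i \<in> fst ` g"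
      using g(1) by (force simp: Map.graph_def)+
    ultimately show "(i, m) \<in> Map.graph (x |` (fst ` g))"
      by (simp add: Map.graph_def)
  qed
  then have "x |` (fst ` g) \<in> submaps k x" "x |` (fst ` g) \<in> submaps k y"
    using g by (auto simp: submaps_def nsets_def)
  then show "\<exists>a. a \<in> submaps k x \<and> a \<in> submaps k y" by blast
next
  assume "\<exists>a. a \<in> submaps k x \<and> a \<in> submaps k y"
  then obtain a where "Map.graph a \<subseteq> Map.graph x \<inter> Map.graph y" "card (Map.graph a) = k"
    by (auto simp: submaps_def nsets_def)
  then show "card_ge (Map.graph x \<inter> Map.graph y) k"
    unfolding card_ge_def using card_mono[of "Map.graph x \<inter> Map.graph y" "Map.graph a"] by blast
qed

theorem theorem1:
  fixes k :: nat and I :: "real set" and M :: "'m set"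
    and \<phi> :: "(real \<rightharpoonup> 'm) \<rightharpoonup> (real \<rightharpoonup> 'm)"
  assumes "k \<ge> 1"
    and "card_ge I (k + 1)"
    and "dom \<phi> \<subseteq> (\<Union>\<alpha>\<in>nsets I k. maps_on \<alpha> M)"
    and "ran \<phi> \<subseteq> maps_on I M"
  shows "limited_intersection_flow k I M \<phi> \<longleftrightarrow>
    (\<forall>a\<in>dom \<phi>. \<forall>\<beta>\<in>nsets I k.
       the (\<phi> a) |` \<beta> \<in> dom \<phi> \<and>
       the (\<phi> (the (\<phi> a) |` \<beta>)) = the (\<phi> a) \<and>
       the (\<phi> a) |` dom a = a)"
proof -
  have dom_I: "dom x = I" if "x \<in> ran \<phi>" for x
    using assms(4) that by (auto simp: maps_on_def)
  have dom_k: "dom a \<in> nsets I k" if "a \<in> dom \<phi>" for a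
    using assms(3) that by (auto simp: maps_on_def)
  have val: "the (\<phi> a) \<in> ran \<phi>" if "a \<in> dom \<phi>" for a
    using that by (auto intro: ranI)
  show ?thesis
  proof (intro iffI ballI)
    fix a \<beta>
    assume "limited_intersection_flow k I M \<phi>" and a: "a \<in> dom \<phi>" and \<beta>: "\<beta> \<in> nsets I k"
    \<comment> \<open>The sets \<open>A\<close> and \<open>X\<close> in the definition of a flow can
      only be \<open>dom \<phi>\<close> and \<open>ran \<phi>\<close>.\<close>
    then have lim: "x1 = x2"
      if "x1 \<in> ran \<phi>" "x2 \<in> ran \<phi>" "card_ge (Map.graph x1 \<inter> Map.graph x2) k" for x1 x2
      using that by (auto simp: limited_intersection_flow_def limited_intersection_def)
    have dom_eq: "dom \<phi> = (\<Union>x\<in>ran \<phi>. submaps k x)"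
      and ext: "\<And>a. a \<in> dom \<phi> \<Longrightarrow> a \<subseteq>\<^sub>m the (\<phi> a)"
      using \<open>limited_intersection_flow k I M \<phi>\<close> unfolding limited_intersection_flow_def by blast+
    define x where "x = the (\<phi> a)"
    define b where "b = x |` \<beta>"
    have x: "x \<in> ran \<phi>"
      using val a by (simp add: x_def)
    then have b: "b \<in> submaps k x" "dom b = \<beta>"
      using restrict_in_submaps[of \<beta> x k] \<beta> by (simp_all add: dom_I b_def)
    with x have b_dom: "b \<in> dom \<phi>"
      using dom_eq by blast
    \<comment> \<open>By the extension property \<open>b\<close> lies below its own value, and by
      construction it lies below \<open>x\<close>. Both are worldlines in the range, so limited
      intersection identifies them.\<close>
    have "b \<in> submaps k (the (\<phi> b))"
      using ext[OF b_dom] val[OF b_dom] \<beta> b(2) by (simp add: submaps_iff dom_I)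
    with b have "the (\<phi> b) = x"
      using lim val b_dom x card_ge_graph_Int_iff by metis
    moreover have "x |` dom a = a"
      using ext[OF a] by (simp add: x_def map_le_iff_restrict)
    ultimately show "the (\<phi> a) |` \<beta> \<in> dom \<phi> \<and>
       the (\<phi> (the (\<phi> a) |` \<beta>)) = the (\<phi> a) \<and> the (\<phi> a) |` dom a = a"
      using b_dom by (simp add: x_def b_def)
  next
    assume eqs: "\<forall>a\<in>dom \<phi>. \<forall>\<beta>\<in>nsets I k.
       the (\<phi> a) |` \<beta> \<in> dom \<phi> \<and>
       the (\<phi> (the (\<phi> a) |` \<beta>)) = the (\<phi> a) \<and>
       the (\<phi> a) |` dom a = a"
    \<comment> \<open>The second equality stands under the quantifier over \<beta>, so some \<beta>
      has to exist; \<open>dom a\<close> is one.\<close>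
    have ext: "a \<subseteq>\<^sub>m the (\<phi> a)" if "a \<in> dom \<phi>" for a
      using eqs dom_k[OF that] that by (simp add: map_le_iff_restrict)
    \<comment> \<open>Write x as the value at some \<open>c\<close> and take \<open>dom a\<close>
      for \<beta>: the restriction of x to \<beta> is then \<open>a\<close> itself, and the first
      equality at \<open>c\<close> says that \<open>a\<close> is in the domain and has value
      x.\<close>
    have sub: "a \<in> dom \<phi> \<and> the (\<phi> a) = x" if "x \<in> ran \<phi>" "a \<in> submaps k x" for x a
    proof -
      obtain c where c: "c \<in> dom \<phi>" "the (\<phi> c) = x"
        using \<open>x \<in> ran \<phi>\<close> by (force simp: ran_def)
      have "x |` dom a = a" "dom a \<in> nsets I k"
        using that by (auto simp: submaps_iff map_le_iff_restrict dom_I)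
      then show ?thesis
        using eqs c by metis
    qed
    \<comment> \<open>If \<open>a\<close> is a common submap of two worldlines in the range, both
      equal the value of \<phi> at \<open>a\<close>.\<close>
    have "limited_intersection k I M (ran \<phi>)"
      unfolding limited_intersection_def card_ge_graph_Int_iff
      using assms(4) sub by blast
    \<comment> \<open>Each \<open>a\<close> is a submap of its own value by \<open>ext\<close>; the
      converse inclusion is the domain part of \<open>sub\<close>.\<close>
    moreover have "dom \<phi> = (\<Union>x\<in>ran \<phi>. submaps k x)"
    proof (intro equalityI subsetI)
      fix a assume a: "a \<in> dom \<phi>"
      then have "a \<in> submaps k (the (\<phi> a))"
        using ext dom_k val by (simp add: submaps_iff dom_I)
      with val[OF a] show "a \<in> (\<Union>x\<in>ran \<phi>. submaps k x)" by blast
    qed (use sub in blast)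
    ultimately show "limited_intersection_flow k I M \<phi>"
      unfolding limited_intersection_flow_def using ext by blast
  qed
qed

end
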